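(* Let $T=\{2341,2413,3412\}$ and let $F=F_T(x)=\sum_{n\ge0}|S_n(T)|x^n$. Then $F$ satisfies $$F=(1-x)^2+xF+x(2-3x+2x^2)F^2-x^2(1-x)F^3.$$
   Context: $S_n$ is the set of permutations of $[n]$ ($S_0$ contains the empty permutation). A permutation avoids a pattern $\tau$ if it has no subsequence order-isomorphic to $\tau$; $S_n(T)$ is the set of permutations in $S_n$ avoiding every pattern in $T$. *)

theory Defs
  imports
    "HOL-Combinatorics.Multiset_Permutations"
    "HOL-Computational_Algebra.Formal_Power_Series"
    "HOL-Library.Sublist"
begin

text \<open>
  Permutations of \<open>[n] = {1, \<dots>, n}\<close> and patterns are written in one-line notation, as lists;
  \<^const>\<open>permutations_of_set\<close> is the library's set of such words. Subsequences are not
  required to be contiguous (\<^const>\<open>subseq\<close>).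
\<close>

definition order_isomorphic :: "nat list \<Rightarrow> nat list \<Rightarrow> bool" where
  "order_isomorphic xs ys \<longleftrightarrow>
     length xs = length ys \<and>
     (\<forall>i < length xs. \<forall>j < length xs. xs ! i < xs ! j \<longleftrightarrow> ys ! i < ys ! j)"

definition avoids :: "nat list \<Rightarrow> nat list \<Rightarrow> bool" where
  "avoids \<pi> \<tau> \<longleftrightarrow> \<not> (\<exists>\<sigma>. subseq \<sigma> \<pi> \<and> order_isomorphic \<sigma> \<tau>)"

definition avoiders :: "nat \<Rightarrow> nat list set \<Rightarrow> nat list set" where
  "avoiders n T = {\<pi> \<in> permutations_of_set {1..n}. \<forall>\<tau>\<in>T. avoids \<pi> \<tau>}"

definition avoiders_gf :: "nat list set \<Rightarrow> int fps" where
  "avoiders_gf T = Abs_fps (\<lambda>n. int (card (avoiders n T)))"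

end

theory Submission
  imports Defs
begin

text \<open>
  Write an avoider as \<open>L n R\<close>, where \<open>n\<close> is its maximum. Either \<open>L < R\<close>, and then
  \<open>L\<close> and \<open>R\<close> are arbitrary avoiders because the three patterns are sum-indecomposable;
  or there is an inversion between \<open>L\<close> and \<open>R\<close>, and \<open>W\<close> counts these avoiders. In the
  second case all values between \<open>max L\<close> and \<open>n\<close> are forced to follow \<open>n\<close> immediately,
  in decreasing order; peeling them off one by one leads to \<open>max L = n - 1\<close>, and then \<open>R\<close>
  is decreasing. Let \<open>V\<close> count these pairs \<open>(L, R)\<close> by total length, and let \<open>U\<close> count
  all pairs with \<open>R\<close> nonempty and decreasing for which \<open>L n R\<close> is an avoider. If the maximum
  \<open>M\<close> of a pair counted by \<open>U\<close> lies on the left, \<open>L = A M B\<close>, then \<open>A\<close> is an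
  arbitrary avoider below everything else and \<open>(B, R)\<close> is again counted by \<open>U\<close>; otherwise
  \<open>M\<close> is the first letter of \<open>R\<close>, and deleting it leaves a pair counted by \<open>U\<close> or, if
  \<open>R = M\<close>, an arbitrary avoider \<open>L\<close>. Hence \<open>F = 1 + x F\<^sup>2 + W\<close>,
  \<open>W = x V + x W\<close>, \<open>U = V + x F + x U\<close> and \<open>V = x F U\<close>, and elimination gives the
  cubic equation.
\<close>

subsection \<open>Avoidance of the three patterns\<close>

text \<open>In the order of the conjuncts, the excluded chains are the patterns 2341, 2413 and 3412,
  with \<open>a\<close>, \<open>b\<close>, \<open>c\<close>, \<open>d\<close> named by
  position.\<close>

definition good :: "nat list \<Rightarrow> bool" where
  "good xs \<longleftrightarrow> (\<forall>a b c d. subseq [a, b, c, d] xs \<longrightarrow>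
     \<not> (d < a \<and> a < b \<and> b < c) \<and> \<not> (c < a \<and> a < d \<and> d < b) \<and> \<not> (c < d \<and> d < a \<and> a < b))"

text \<open>Unfolds the choice of a cut of an explicit list letter by letter, so that
  \<open>subseq_append_iff\<close> becomes a finite disjunction over cut positions.\<close>

lemma ex_append_split:
  "(\<exists>us vs. [] = us @ vs \<and> P us vs) \<longleftrightarrow> P [] []"
  "(\<exists>us vs. x # xs = us @ vs \<and> P us vs) \<longleftrightarrow>
     P [] (x # xs) \<or> (\<exists>us vs. xs = us @ vs \<and> P (x # us) vs)"
  by (auto simp: Cons_eq_append_conv)

lemma subseq2_append:
  "subseq [a, b] (xs @ ys) \<longleftrightarrow>
     subseq [a, b] xs \<or> (a \<in> set xs \<and> b \<in> set ys) \<or> subseq [a, b] ys"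
  unfolding subseq_append_iff ex_append_split by (auto simp: subseq_singleton_left)

lemma subseq3_append:
  "subseq [a, b, c] (xs @ ys) \<longleftrightarrow>
     subseq [a, b, c] xs \<or> (subseq [a, b] xs \<and> c \<in> set ys) \<or>
     (a \<in> set xs \<and> subseq [b, c] ys) \<or> subseq [a, b, c] ys"
  unfolding subseq_append_iff ex_append_split by (auto simp: subseq_singleton_left)

lemma subseq4_append:
  "subseq [a, b, c, d] (xs @ ys) \<longleftrightarrow>
     subseq [a, b, c, d] xs \<or> (subseq [a, b, c] xs \<and> d \<in> set ys) \<or>
     (subseq [a, b] xs \<and> subseq [c, d] ys) \<or>
     (a \<in> set xs \<and> subseq [b, c, d] ys) \<or> subseq [a, b, c, d] ys"
  unfolding subseq_append_iff ex_append_split by (auto simp: subseq_singleton_left)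

lemma subseq2_Cons: "subseq [a, b] (x # xs) \<longleftrightarrow> (a = x \<and> b \<in> set xs) \<or> subseq [a, b] xs"
  using subseq2_append[of a b "[x]" xs] by auto

lemma subseq3_Cons:
  "subseq [a, b, c] (x # xs) \<longleftrightarrow> (a = x \<and> subseq [b, c] xs) \<or> subseq [a, b, c] xs"
  using subseq3_append[of a b c "[x]" xs] by auto

lemma subseq4_Cons:
  "subseq [a, b, c, d] (x # xs) \<longleftrightarrow>
     (a = x \<and> subseq [b, c, d] xs) \<or> subseq [a, b, c, d] xs"
  using subseq4_append[of a b c d "[x]" xs] by auto

lemmas subseq_splits = subseq2_append subseq3_append subseq4_append
  subseq2_Cons subseq3_Cons subseq4_Cons

lemma subseq_set_mono: "subseq xs ys \<Longrightarrow> set xs \<subseteq> set ys"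
  by (induction rule: list_emb.induct) auto

lemma subseq2_D: "subseq [a, b] xs \<Longrightarrow> a \<in> set xs \<and> b \<in> set xs"
  using subseq_set_mono[of "[a, b]" xs] by simp

text \<open>
  With a maximal letter placed between the two words, \<open>no_low_ascent\<close> rules out the occurrences of
  2413 and 3412 in which that letter plays the 4, and \<open>no_high_ascent\<close> those of 2341.
\<close>

definition no_low_ascent :: "nat list \<Rightarrow> nat list \<Rightarrow> bool" where
  "no_low_ascent ys xs \<longleftrightarrow> (\<forall>a\<in>set ys. \<forall>c d. subseq [c, d] xs \<longrightarrow> \<not> (c < a \<and> c < d))"

definition no_high_ascent :: "nat list \<Rightarrow> nat list \<Rightarrow> bool" where
  "no_high_ascent xs ys \<longleftrightarrow> (\<forall>a b. subseq [a, b] xs \<longrightarrow> a < b \<longrightarrow> (\<forall>c\<in>set ys. \<not> c < a))"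

section \<open>Concatenations and insertion of a maximal letter\<close>

lemma good_subseq: "good ys \<Longrightarrow> subseq xs ys \<Longrightarrow> good xs"
  unfolding good_def by (meson subseq_order.trans)

text \<open>Holds because 2341, 2413 and 3412 are sum-indecomposable: no occurrence can be cut into
  a lower left part and a higher right part.\<close>

lemma good_append_less:
  assumes "\<forall>a\<in>set xs. \<forall>b\<in>set ys. a < b"
  shows "good (xs @ ys) \<longleftrightarrow> good xs \<and> good ys"
proof
  show "good (xs @ ys) \<Longrightarrow> good xs \<and> good ys"
    by (meson good_subseq subseq_drop_many subseq_rev_drop_many subseq_order.refl)
  assume g: "good xs \<and> good ys"
  show "good (xs @ ys)"
    unfolding good_def
  proof (intro allI impI)
    fix a b c d assume s: "subseq [a, b, c, d] (xs @ ys)"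
    show "\<not> (d < a \<and> a < b \<and> b < c) \<and> \<not> (c < a \<and> a < d \<and> d < b) \<and> \<not> (c < d \<and> d < a \<and> a < b)"
    proof (cases "subseq [a, b, c, d] xs \<or> subseq [a, b, c, d] ys")
      case True
      then show ?thesis using g unfolding good_def by blast
    next
      case False
      \<comment> \<open>The occurrence meets both words, so \<open>a < d\<close>, which excludes
        2341 and 3412. A cut after the first or second letter gives \<open>a < c\<close>, one after
        the second or third gives \<open>b < d\<close>; either excludes 2413.\<close>
      then have "a < d \<and> (b < d \<or> a < c)"
        using s assms unfolding subseq4_append
        by (elim disjE) (auto dest!: subseq_set_mono)
      then show ?thesis by auto
    qed
  qed
qed

text \<open>A maximal letter can only play the 4, so each new occurrence of a pattern reduces to a
  condition on its three other letters.\<close>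

lemma good_insert_max:
  assumes "\<forall>x\<in>set xs \<union> set ys. x < n" "distinct (xs @ ys)"
  shows "good (xs @ n # ys) \<longleftrightarrow> good (xs @ ys) \<and> no_low_ascent xs ys \<and> no_high_ascent xs ys"
proof
  assume g: "good (xs @ n # ys)"
  have "subseq (xs @ ys) (xs @ n # ys)" unfolding subseq_append' by auto
  then have "good (xs @ ys)" using g good_subseq by blast
  moreover have "no_low_ascent xs ys"
    unfolding no_low_ascent_def
  proof (intro ballI allI impI notI)
    fix a c d assume h: "a \<in> set xs" "subseq [c, d] ys" "c < a \<and> c < d"
    then have "subseq [a, n, c, d] (xs @ n # ys)" by (simp add: subseq_splits)
    \<comment> \<open>Comparing \<open>d\<close> with \<open>a\<close> decides which pattern
      \<open>a n c d\<close> is: 2413 if \<open>a < d\<close>, 3412 if \<open>d < a\<close>.\<close>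
    moreover have "d \<noteq> a" "d < n" "a < n" using h subseq2_D[OF h(2)] assms by auto
    ultimately show False using g h unfolding good_def by (meson linorder_neqE_nat)
  qed
  moreover have "no_high_ascent xs ys"
    unfolding no_high_ascent_def
  proof (intro ballI allI impI notI)
    fix a b c assume h: "subseq [a, b] xs" "a < b" "c \<in> set ys" "c < a"
    then have "subseq [a, b, n, c] (xs @ n # ys)" by (simp add: subseq_splits subseq_singleton_left)
    moreover have "b < n" using h subseq2_D[OF h(1)] assms by auto
    ultimately show False using g h unfolding good_def by blast
  qed
  ultimately show "good (xs @ ys) \<and> no_low_ascent xs ys \<and> no_high_ascent xs ys" by blast
next
  assume g: "good (xs @ ys) \<and> no_low_ascent xs ys \<and> no_high_ascent xs ys"
  have low: "c < a \<Longrightarrow> c < d \<Longrightarrow> a \<in> set xs \<Longrightarrow> subseq [c, d] ys \<Longrightarrow> False" for a c d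
    using g unfolding no_low_ascent_def by blast
  have high: "a < b \<Longrightarrow> c < a \<Longrightarrow> c \<in> set ys \<Longrightarrow> subseq [a, b] xs \<Longrightarrow> False" for a b c
    using g unfolding no_high_ascent_def by blast
  have lt: "x \<in> set xs \<Longrightarrow> x < n" "x \<in> set ys \<Longrightarrow> x < n" for x using assms(1) by auto
  show "good (xs @ n # ys)"
    unfolding good_def
  proof (intro allI impI)
    fix a b c d assume s: "subseq [a, b, c, d] (xs @ n # ys)"
    show "\<not> (d < a \<and> a < b \<and> b < c) \<and> \<not> (c < a \<and> a < d \<and> d < b) \<and> \<not> (c < d \<and> d < a \<and> a < b)"
    proof (cases "subseq [a, b, c, d] (xs @ ys)")
      case True
      then show ?thesis using g unfolding good_def by blast
    next
      case False
      have mem: "{a, b, c, d} \<subseteq> insert n (set xs \<union> set ys)"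
        using subseq_set_mono[OF s] by auto
      then have "a \<le> n" "b \<le> n" "c \<le> n" "d \<le> n" using lt by (auto intro: less_imp_le)
      \<comment> \<open>The four places of \<open>n\<close> in the occurrence. No pattern has its 4
        at either end; the third place leaves only 2341, the second only 2413 and 3412.\<close>
      moreover have "(subseq [a, b, c] xs \<and> d = n) \<or> (subseq [a, b] xs \<and> c = n \<and> d \<in> set ys) \<or>
          (a \<in> set xs \<and> b = n \<and> subseq [c, d] ys) \<or> (a = n \<and> subseq [b, c, d] ys)"
        using s False unfolding subseq_splits subseq_singleton_left set_simps insert_iff by argo
      ultimately show ?thesis
      proof (elim disjE conjE, goal_cases)
        case 2
        then show ?case using high[of a b d] by auto
      next
        case 3
        then show ?case using low[of c a d] by auto
      qed auto
    qed
  qed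
qed

lemma sorted_wrt_subseq: "sorted_wrt P xs \<longleftrightarrow> (\<forall>c d. subseq [c, d] xs \<longrightarrow> P c d)"
proof (induction xs)
  case (Cons x xs)
  then show ?case unfolding subseq_splits by auto
qed simp

section \<open>Invariance under strictly increasing relabelling\<close>

lemma subseq_map_iff: "subseq ys (map f xs) \<longleftrightarrow> (\<exists>zs. ys = map f zs \<and> subseq zs xs)"
  by (auto simp: subseq_conv_nths nths_map)

lemma subseq2_map:
  "subseq [a, b] (map f xs) \<longleftrightarrow> (\<exists>a' b'. a = f a' \<and> b = f b' \<and> subseq [a', b'] xs)"
proof
  show "subseq [a, b] (map f xs) \<Longrightarrow> \<exists>a' b'. a = f a' \<and> b = f b' \<and> subseq [a', b'] xs"
    unfolding subseq_map_iff by (auto simp: Cons_eq_map_conv)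
qed (auto dest: subseq_map[of _ _ f])

lemma subseq4_map:
  "subseq [a, b, c, d] (map f xs) \<longleftrightarrow>
     (\<exists>a' b' c' d'. a = f a' \<and> b = f b' \<and> c = f c' \<and> d = f d' \<and> subseq [a', b', c', d'] xs)"
proof
  show "subseq [a, b, c, d] (map f xs) \<Longrightarrow>
    \<exists>a' b' c' d'. a = f a' \<and> b = f b' \<and> c = f c' \<and> d = f d' \<and> subseq [a', b', c', d'] xs"
    unfolding subseq_map_iff by (auto simp: Cons_eq_map_conv)
qed (auto dest: subseq_map[of _ _ f])

lemma good_map:
  assumes "strict_mono f"
  shows "good (map f xs) \<longleftrightarrow> good xs"
proof -
  have lt: "f x < f y \<longleftrightarrow> x < y" for x y by (simp add: assms strict_mono_less)
  show ?thesis
  proof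
    assume g: "good (map f xs)"
    show "good xs"
      unfolding good_def
    proof (intro allI impI)
      fix a b c d assume "subseq [a, b, c, d] xs"
      then have "subseq [f a, f b, f c, f d] (map f xs)"
        using subseq_map[of "[a, b, c, d]" xs f] by simp
      then have "\<not> (f d < f a \<and> f a < f b \<and> f b < f c) \<and> \<not> (f c < f a \<and> f a < f d \<and> f d < f b) \<and>
          \<not> (f c < f d \<and> f d < f a \<and> f a < f b)"
        using g unfolding good_def by blast
      then show "\<not> (d < a \<and> a < b \<and> b < c) \<and> \<not> (c < a \<and> a < d \<and> d < b) \<and> \<not> (c < d \<and> d < a \<and> a < b)"
        unfolding lt .
    qed
  next
    assume g: "good xs"
    show "good (map f xs)"
      unfolding good_def
    proof (intro allI impI)
      fix a b c d assume "subseq [a, b, c, d] (map f xs)"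
      then obtain a' b' c' d' where
        "subseq [a', b', c', d'] xs" and eq: "a = f a'" "b = f b'" "c = f c'" "d = f d'"
        unfolding subseq4_map by blast
      then show "\<not> (d < a \<and> a < b \<and> b < c) \<and> \<not> (c < a \<and> a < d \<and> d < b) \<and> \<not> (c < d \<and> d < a \<and> a < b)"
        using g unfolding good_def eq lt by blast
    qed
  qed
qed

lemma no_high_ascent_map:
  assumes "strict_mono f"
  shows "no_high_ascent (map f xs) (map f ys) \<longleftrightarrow> no_high_ascent xs ys"
proof -
  have lt: "f x < f y \<longleftrightarrow> x < y" for x y by (simp add: assms strict_mono_less)
  show ?thesis
  proof
    assume h: "no_high_ascent (map f xs) (map f ys)"
    show "no_high_ascent xs ys"
      unfolding no_high_ascent_def
    proof (intro allI impI ballI)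
      fix a b c assume "subseq [a, b] xs" "a < b" "c \<in> set ys"
      then have "subseq [f a, f b] (map f xs)" "f a < f b" "f c \<in> set (map f ys)"
        by (auto simp: subseq2_map lt)
      then have "\<not> f c < f a" using h unfolding no_high_ascent_def by blast
      then show "\<not> c < a" by (simp add: lt)
    qed
  next
    assume h: "no_high_ascent xs ys"
    show "no_high_ascent (map f xs) (map f ys)"
      unfolding no_high_ascent_def
    proof (intro allI impI ballI)
      fix a b c assume "subseq [a, b] (map f xs)" "a < b" "c \<in> set (map f ys)"
      then obtain a' b' c' where "subseq [a', b'] xs" "a = f a'" "b = f b'" "c = f c'" "c' \<in> set ys"
        unfolding subseq2_map by auto
      then show "\<not> c < a" using h \<open>a < b\<close> unfolding no_high_ascent_def by (auto simp: lt)
    qed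
  qed
qed

text \<open>A low ascent is in particular an ascent of \<open>ys\<close>. For a decreasing right
  word, inserting a maximum is therefore governed by \<open>no_high_ascent\<close> alone, which is
  the condition recorded in \<open>dec_pairs\<close>.\<close>

lemma no_low_ascent_sorted: "sorted_wrt (>) ys \<Longrightarrow> no_low_ascent xs ys"
  unfolding no_low_ascent_def sorted_wrt_subseq by (meson less_asym)

subsection \<open>Avoiders of an interval\<close>

text \<open>With half-open intervals, a cut at \<open>k\<close> yields \<open>{a<..k}\<close> and
  \<open>{k<..b}\<close>, and the word length is exactly \<open>b - a\<close>.\<close>

definition good_words :: "nat \<Rightarrow> nat \<Rightarrow> nat list set" where
  "good_words a b = {xs. set xs = {a<..b} \<and> distinct xs \<and> good xs}"

definition dec_pairs :: "nat \<Rightarrow> nat \<Rightarrow> (nat list \<times> nat list) set" where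
  "dec_pairs a b = {(xs, ys). set (xs @ ys) = {a<..b} \<and> distinct (xs @ ys) \<and> ys \<noteq> [] \<and>
     sorted_wrt (>) ys \<and> good (xs @ ys) \<and> no_high_ascent xs ys}"

text \<open>
  The pairs counted by \<open>U\<close>, \<open>V\<close> and \<open>W\<close> are \<open>dec_pairs\<close>, \<open>top_pairs\<close> and
  \<open>inv_pairs\<close>. The maximal letter between the two words is left out in the first two and counts
  towards the size in the third.
\<close>

definition top_pairs :: "nat \<Rightarrow> (nat list \<times> nat list) set" where
  "top_pairs b = {(xs, ys) \<in> dec_pairs 0 b. b \<in> set xs}"

definition inv_pairs :: "nat \<Rightarrow> (nat list \<times> nat list) set" where
  "inv_pairs n = {(xs, ys). xs @ n # ys \<in> good_words 0 n \<and> (\<exists>a\<in>set xs. \<exists>c\<in>set ys. c < a)}"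

lemma finite_good_words [simp]: "finite (good_words a b)"
  by (rule finite_subset[OF _ finite_permutations_of_set[of "{a<..b}"]])
     (auto simp: good_words_def permutations_of_set_def)

lemma finite_dec_pairs [simp]: "finite (dec_pairs a b)"
proof (rule finite_subset)
  \<comment> \<open>A pair is recovered from its concatenation and the position of the cut.\<close>
  show "dec_pairs a b \<subseteq> (\<lambda>(xs, k). (take k xs, drop k xs)) ` (good_words a b \<times> {..b - a})"
  proof clarify
    fix xs ys assume h: "(xs, ys) \<in> dec_pairs a b"
    then have "xs @ ys \<in> good_words a b" by (auto simp: dec_pairs_def good_words_def)
    moreover have "length (xs @ ys) = b - a"
      using h distinct_card[of "xs @ ys"] by (auto simp: dec_pairs_def simp del: length_append)
    ultimately show "(xs, ys) \<in> (\<lambda>(xs, k). (take k xs, drop k xs)) ` (good_words a b \<times> {..b - a})"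
      by (intro image_eqI[of _ _ "(xs @ ys, length xs)"]) auto
  qed
qed auto

lemma finite_top_pairs [simp]: "finite (top_pairs n)"
  by (rule finite_subset[OF _ finite_dec_pairs[of 0 n]]) (auto simp: top_pairs_def)

section \<open>Translation of intervals\<close>

lemma shift_interval: "a \<le> b \<Longrightarrow> (+) a ` S = {a<..b} \<longleftrightarrow> S = {0<..b - (a::nat)}"
proof -
  assume "a \<le> b"
  then have "(+) a ` {0<..b - a} = {a<..b}" by (simp add: image_add_greaterThanAtMost)
  then show ?thesis by (metis inj_image_eq_iff inj_on_add)
qed

lemma map_shift_ex: "\<forall>x\<in>set xs. a \<le> x \<Longrightarrow> \<exists>zs. xs = map ((+) (a::nat)) zs"
  by (rule exI[of _ "map (\<lambda>x. x - a) xs"]) (simp add: map_idI)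

lemma strict_mono_shift: "strict_mono ((+) (a::nat))"
  by (simp add: strict_mono_def)

lemma card_good_words: "a \<le> b \<Longrightarrow> card (good_words a b) = card (good_words 0 (b - a))"
proof -
  assume ab: "a \<le> b"
  have "good_words a b = map ((+) a) ` good_words 0 (b - a)"
  proof (intro equalityI subsetI)
    fix xs assume xs: "xs \<in> good_words a b"
    then obtain zs where "xs = map ((+) a) zs"
      using map_shift_ex[of xs a] by (auto simp: good_words_def)
    then show "xs \<in> map ((+) a) ` good_words 0 (b - a)"
      using xs ab by (auto simp: good_words_def shift_interval good_map[OF strict_mono_shift]
          distinct_map)
  next
    fix xs assume "xs \<in> map ((+) a) ` good_words 0 (b - a)"
    then show "xs \<in> good_words a b"
      using ab by (auto simp: good_words_def shift_interval good_map[OF strict_mono_shift]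
          distinct_map
          image_add_greaterThanAtMost simp del: set_map simp add: list.set_map)
  qed
  then show ?thesis by (simp add: card_image inj_on_subset[of _ UNIV])
qed

lemma card_dec_pairs: "a \<le> b \<Longrightarrow> card (dec_pairs a b) = card (dec_pairs 0 (b - a))"
proof -
  assume ab: "a \<le> b"
  let ?f = "map_prod (map ((+) a)) (map ((+) a))"
  have iff: "(map ((+) a) us, map ((+) a) vs) \<in> dec_pairs a b \<longleftrightarrow> (us, vs) \<in> dec_pairs 0 (b - a)"
    for us vs
  proof -
    have "set (map ((+) a) (us @ vs)) = {a<..b} \<longleftrightarrow> set (us @ vs) = {0<..b - a}"
      using shift_interval[OF ab, of "set (us @ vs)"] by (simp only: set_map)
    moreover have "distinct (map ((+) a) (us @ vs)) \<longleftrightarrow> distinct (us @ vs)"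
      unfolding distinct_map by (simp add: inj_on_subset[of _ UNIV])
    moreover have "sorted_wrt (>) (map ((+) a) vs) \<longleftrightarrow> sorted_wrt (>) vs"
      by (simp add: sorted_wrt_map)
    ultimately show ?thesis
      unfolding dec_pairs_def mem_Collect_eq prod.case map_append[symmetric]
        good_map[OF strict_mono_shift] no_high_ascent_map[OF strict_mono_shift] by simp
  qed
  have "dec_pairs a b = ?f ` dec_pairs 0 (b - a)"
  proof (intro equalityI subsetI)
    fix p assume p: "p \<in> dec_pairs a b"
    obtain xs ys where xy: "p = (xs, ys)" by fastforce
    have "\<forall>x \<in> set xs \<union> set ys. a \<le> x" using p xy by (auto simp: dec_pairs_def)
    then obtain us vs where "xs = map ((+) a) us" "ys = map ((+) a) vs"
      using map_shift_ex by (meson UnCI)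
    then show "p \<in> ?f ` dec_pairs 0 (b - a)"
      using p xy iff by (auto intro!: image_eqI[of _ _ "(us, vs)"])
  next
    fix p assume "p \<in> ?f ` dec_pairs 0 (b - a)"
    then show "p \<in> dec_pairs a b" using iff by auto
  qed
  moreover have "inj ?f" by (simp add: prod.inj_map)
  ultimately show ?thesis by (simp add: card_image inj_on_subset[of _ UNIV])
qed

text \<open>Turns the separation of two words by value into one cut index, the summation index of
  the convolutions below.\<close>

lemma interval_split:
  fixes a b :: nat
  assumes "X \<union> Y = {a<..b}" "\<forall>x\<in>X. \<forall>y\<in>Y. x < y" "a \<le> b"
  shows "\<exists>k\<in>{a..b}. X = {a<..k} \<and> Y = {k<..b}"
proof -
  \<comment> \<open>Inserting \<open>a\<close> makes the maximum meaningful for empty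
    \<open>X\<close>, where the cut is at \<open>a\<close>.\<close>
  define k where "k = Max (insert a X)"
  have fin: "finite X" using assms(1) by (metis finite_Un finite_greaterThanAtMost)
  have k: "k \<in> insert a X" unfolding k_def using fin by (intro Max_in) auto
  have sub: "X \<subseteq> {a<..b}" using assms(1) by auto
  have le: "x \<in> X \<Longrightarrow> x \<le> k" for x unfolding k_def using fin by auto
  have ab: "k \<in> {a..b}" using k sub assms(3) by auto
  have "x \<in> X \<longleftrightarrow> a < x \<and> x \<le> k" for x
  proof
    show "x \<in> X \<Longrightarrow> a < x \<and> x \<le> k" using le assms(1) by auto
    assume h: "a < x \<and> x \<le> k"
    then have "x \<in> X \<union> Y" "k \<in> X" using assms(1) ab k by auto
    then show "x \<in> X" using h assms(2) by fastforce
  qed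
  moreover have "y \<in> Y \<longleftrightarrow> k < y \<and> y \<le> b" for y
  proof
    show "y \<in> Y \<Longrightarrow> k < y \<and> y \<le> b" using k assms(1,2) by auto
    assume h: "k < y \<and> y \<le> b"
    then have "y \<in> X \<union> Y" using assms(1) ab by auto
    then show "y \<in> Y" using h le by fastforce
  qed
  ultimately show ?thesis using ab by (intro bexI[of _ k]) auto
qed

text \<open>Both ascent conditions forbid configurations containing a letter of \<open>ys\<close>
  below a letter of \<open>xs\<close>, so they hold automatically here.\<close>

lemma good_split_max:
  assumes "\<forall>x\<in>set xs. \<forall>y\<in>set ys. x < y" "\<forall>x\<in>set xs \<union> set ys. x < n" "distinct (xs @ ys)"
  shows "good (xs @ n # ys) \<longleftrightarrow> good xs \<and> good ys"
proof -
  have "no_low_ascent xs ys"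
    unfolding no_low_ascent_def
  proof (intro ballI allI impI)
    fix a c d assume "a \<in> set xs" "subseq [c, d] ys"
    then show "\<not> (c < a \<and> c < d)" using subseq2_D assms(1) by (metis less_asym)
  qed
  moreover have "no_high_ascent xs ys"
    unfolding no_high_ascent_def
  proof (intro ballI allI impI)
    fix a b c assume "c \<in> set ys" "subseq [a, b] xs"
    then show "\<not> c < a" using subseq2_D assms(1) by (metis less_asym)
  qed
  ultimately show ?thesis
    using good_insert_max[OF assms(2,3)] good_append_less[OF assms(1)] by blast
qed

lemma good_words_0 [simp]: "good_words a a = {[]}"
  by (auto simp: good_words_def good_def)

lemma interval_delete_max:
  fixes a m :: nat
  assumes "insert (Suc m) X = {a<..Suc m}" "Suc m \<notin> X"
  shows "X = {a<..m}"
proof -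
  have "X = {a<..Suc m} - {Suc m}" using assms by (metis Diff_insert_absorb)
  also have "\<dots> = {a<..m}" by auto
  finally show ?thesis .
qed

lemma insert_interval_max: "insert (Suc m) {0<..m} = {0<..Suc m}"
  by auto

text \<open>Supplies the injectivity of the maps that insert a maximal letter.\<close>

lemma split_unique:
  assumes "xs @ n # ys = xs' @ n # ys'" "distinct (xs @ n # ys)"
  shows "xs = xs'" "ys = ys'"
proof -
  have "n \<notin> set xs" "n \<notin> set ys" using assms(2) by auto
  then have "xs = xs' \<and> ys = ys'" using assms(1) append_Cons_eq_iff by metis
  then show "xs = xs'" "ys = ys'" by simp_all
qed

lemma subseq2_distinct: "distinct xs \<Longrightarrow> subseq [a, b] xs \<Longrightarrow> a \<noteq> b"
proof (induction xs)
  case (Cons x xs)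
  then show ?case unfolding subseq2_Cons by auto
qed simp

lemma card_Sigma_Times:
  assumes "\<And>j. j \<le> m \<Longrightarrow> finite (A j)" "\<And>j. j \<le> m \<Longrightarrow> finite (B j)"
  shows "card (SIGMA j:{..m::nat}. A j \<times> B j) = (\<Sum>j\<le>m. card (A j) * card (B j))"
  using assms by (subst card_SigmaI) (auto simp: card_cartesian_product)

lemma finite_inv_pairs [simp]: "finite (inv_pairs n)"
proof (rule finite_subset)
  \<comment> \<open>\<open>drop (Suc k)\<close> skips the maximal letter, which sits at index
    \<open>k\<close>.\<close>
  show "inv_pairs n \<subseteq> (\<lambda>(xs, k). (take k xs, drop (Suc k) xs)) ` (good_words 0 n \<times> {..n})"
  proof clarify
    fix xs ys assume h: "(xs, ys) \<in> inv_pairs n"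
    then have w: "xs @ n # ys \<in> good_words 0 n" by (auto simp: inv_pairs_def)
    then have "length (xs @ n # ys) = n"
      using distinct_card[of "xs @ n # ys"] by (auto simp: good_words_def simp del: length_append)
    then show "(xs, ys) \<in> (\<lambda>(xs, k). (take k xs, drop (Suc k) xs)) ` (good_words 0 n \<times> {..n})"
      using w by (intro image_eqI[of _ _ "(xs @ n # ys, length xs)"]) auto
  qed
qed auto

subsection \<open>Recurrences\<close>

text \<open>Coefficient form of \<open>F = 1 + x*F^2 + W\<close>: cut at the maximum and ask whether
  an inversion crosses it. Without one, the left word occupies the \<open>j\<close> smallest
  values.\<close>

lemma card_good_words_Suc:
  "card (good_words 0 (Suc m)) =
     (\<Sum>j\<le>m. card (good_words 0 j) * card (good_words 0 (m - j))) + card (inv_pairs (Suc m))"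
proof -
  let ?n = "Suc m"
  let ?D = "SIGMA j:{..m}. good_words 0 j \<times> good_words j m"
  let ?f = "\<lambda>(j::nat, xs, ys). xs @ ?n # ys"
  let ?g = "\<lambda>(xs, ys). xs @ ?n # ys"
  have "good_words 0 ?n = ?f ` ?D \<union> ?g ` inv_pairs ?n"
  proof (intro equalityI subsetI)
    fix w assume w: "w \<in> good_words 0 ?n"
    then have "?n \<in> set w" by (auto simp: good_words_def)
    then obtain xs ys where xy: "w = xs @ ?n # ys" by (meson split_list)
    show "w \<in> ?f ` ?D \<union> ?g ` inv_pairs ?n"
    proof (cases "\<exists>a\<in>set xs. \<exists>c\<in>set ys. c < a")
      case True
      then have "(xs, ys) \<in> inv_pairs ?n" using w xy by (auto simp: inv_pairs_def)
      then show ?thesis using xy by (intro UnI2 image_eqI[of _ _ "(xs, ys)"]) auto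
    next
      case False
      have d: "distinct (xs @ ys)" "?n \<notin> set xs \<union> set ys" using w xy by (auto simp: good_words_def)
      have s: "insert ?n (set xs \<union> set ys) = {0<..?n}" using w xy by (auto simp: good_words_def)
      have u: "set xs \<union> set ys = {0<..m}"
        using interval_delete_max s d(2) by blast
      have lt: "\<forall>x\<in>set xs. \<forall>y\<in>set ys. x < y" using False d(1)
        by (auto simp: disjoint_iff) (metis linorder_neqE_nat)
      obtain j where j: "j \<le> m" "set xs = {0<..j}" "set ys = {j<..m}"
        using interval_split[OF u lt] by auto
      have "good xs \<and> good ys"
        using good_split_max[OF lt _ d(1), of ?n] w xy u by (auto simp: good_words_def)
      then have "(j, xs, ys) \<in> ?D" using j d by (auto simp: good_words_def)
      then show ?thesis using xy by (intro UnI1 image_eqI[of _ _ "(j, xs, ys)"]) auto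
    qed
  next
    fix w assume "w \<in> ?f ` ?D \<union> ?g ` inv_pairs ?n"
    then show "w \<in> good_words 0 ?n"
    proof
      assume "w \<in> ?f ` ?D"
      then obtain j xs ys where h: "j \<le> m" "xs \<in> good_words 0 j" "ys \<in> good_words j m"
        "w = xs @ ?n # ys"
        by auto
      then have s: "set xs = {0<..j}" "set ys = {j<..m}" "distinct xs" "distinct ys"
        "good xs" "good ys" by (auto simp: good_words_def)
      have "good w" unfolding h(4) using s h(1) by (subst good_split_max) auto
      then show ?thesis using s h by (auto simp: good_words_def)
    qed (auto simp: inv_pairs_def)
  qed
  moreover have cancel: "xs = xs' \<and> ys = ys'"
    if "xs @ ?n # ys = xs' @ ?n # ys'" "xs @ ?n # ys \<in> good_words 0 ?n" for xs ys xs' ys'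
  proof -
    have "distinct (xs @ ?n # ys)" using that by (simp add: good_words_def)
    then show ?thesis using split_unique[OF that(1)] by simp
  qed
  moreover have "?f ` ?D \<inter> ?g ` inv_pairs ?n = {}"
  proof -
    have "False" if h: "j \<le> m" "xs \<in> good_words 0 j" "ys \<in> good_words j m"
      "(us, vs) \<in> inv_pairs ?n" "xs @ ?n # ys = us @ ?n # vs" for j xs ys us vs
    proof -
      have "us = xs \<and> vs = ys" using cancel[of us vs xs ys] h by (auto simp: inv_pairs_def)
      then show False using h by (fastforce simp: inv_pairs_def good_words_def)
    qed
    then show ?thesis by auto
  qed
  moreover have "inj_on ?f ?D"
  proof (rule inj_onI)
    fix p q assume pq: "p \<in> ?D" "q \<in> ?D" "?f p = ?f q"
    obtain j xs ys where p: "p = (j, xs, ys)" by (metis prod_cases3)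
    obtain j' xs' ys' where q: "q = (j', xs', ys')" by (metis prod_cases3)
    have d: "distinct (xs @ ?n # ys)" using pq(1) p by (auto simp: good_words_def)
    have "xs @ ?n # ys = xs' @ ?n # ys'" using pq(3) p q by simp
    then have eq: "xs = xs'" "ys = ys'" using split_unique[OF _ d] by simp_all
    \<comment> \<open>The word does not store \<open>j\<close>; it is recovered as the number of
      letters left of the maximum.\<close>
    have "{0<..j} = {0<..j'}" using pq(1,2) p q eq by (simp add: good_words_def)
    then have "card {0<..j} = card {0<..j'}" by simp
    then show "p = q" using eq p q by simp
  qed
  moreover have "inj_on ?g (inv_pairs ?n)"
  proof (rule inj_onI)
    fix p q assume pq: "p \<in> inv_pairs ?n" "q \<in> inv_pairs ?n" "?g p = ?g q"
    obtain xs ys where p: "p = (xs, ys)" by fastforce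
    obtain xs' ys' where q: "q = (xs', ys')" by fastforce
    have d: "xs @ ?n # ys \<in> good_words 0 ?n" using pq(1) p by (auto simp: inv_pairs_def)
    have "xs @ ?n # ys = xs' @ ?n # ys'" using pq(3) p q by simp
    then show "p = q" using cancel[OF _ d] p q by simp
  qed
  moreover have "finite ?D" by (intro finite_SigmaI) auto
  ultimately have "card (good_words 0 ?n) = card ?D + card (inv_pairs ?n)"
    by (simp only: card_Un_disjoint finite_imageI finite_inv_pairs card_image)
  also have "card ?D = (\<Sum>j\<le>m. card (good_words 0 j) * card (good_words j m))"
    by (rule card_Sigma_Times) auto
  also have "\<dots> = (\<Sum>j\<le>m. card (good_words 0 j) * card (good_words 0 (m - j)))"
    by (intro sum.cong) (auto simp: card_good_words[of _ m])
  finally show ?thesis .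
qed

text \<open>Coefficient form of \<open>W = x*V + x*W\<close>, by the position of the second largest
  letter \<open>m\<close>: on the left it forces the right word to decrease; on the right it must
  come first, and deleting the overall maximum leaves \<open>m\<close> as the new separating
  letter.\<close>

lemma card_inv_pairs_Suc: "card (inv_pairs (Suc m)) = card (top_pairs m) + card (inv_pairs m)"
proof -
  let ?n = "Suc m"
  let ?f = "\<lambda>(xs, ys). (xs, m # ys)"
  have "inv_pairs ?n = top_pairs m \<union> ?f ` inv_pairs m"
  proof (intro equalityI subsetI)
    fix p assume p: "p \<in> inv_pairs ?n"
    obtain xs ys where xy: "p = (xs, ys)" by fastforce
    have w: "xs @ ?n # ys \<in> good_words 0 ?n" and ex: "\<exists>a\<in>set xs. \<exists>c\<in>set ys. c < a"
      using p xy by (auto simp: inv_pairs_def)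
    have d: "distinct (xs @ ys)" "?n \<notin> set xs \<union> set ys" using w by (auto simp: good_words_def)
    have s: "insert ?n (set xs \<union> set ys) = {0<..?n}" using w xy by (auto simp: good_words_def)
    have u: "set xs \<union> set ys = {0<..m}" using interval_delete_max s d(2) by blast
    then have lt: "\<forall>x\<in>set xs \<union> set ys. x < ?n" by auto
    have g: "good (xs @ ys)" "no_low_ascent xs ys" "no_high_ascent xs ys"
      using w good_insert_max[OF lt d(1)] by (auto simp: good_words_def)
    have ltm: "x < m" if "x \<in> set xs \<union> set ys" "x \<noteq> m" for x
    proof -
      have "x \<in> {0<..m}" using that(1) u by blast
      then show ?thesis using that(2) by simp
    qed
    obtain a c where ac: "a \<in> set xs" "c \<in> set ys" "c < a" using ex by blast
    show "p \<in> top_pairs m \<union> ?f ` inv_pairs m"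
    proof (cases "m \<in> set xs")
      case True
      \<comment> \<open>As \<open>m\<close> lies on the left and exceeds all of \<open>ys\<close>,
        any ascent of \<open>ys\<close> would be a low ascent.\<close>
      have "sorted_wrt (>) ys"
        unfolding sorted_wrt_subseq
      proof (intro allI impI)
        fix c d assume cd: "subseq [c, d] ys"
        have "c \<in> set ys" using subseq2_D[OF cd] by simp
        then have "c < m" using ltm[of c] d(1) True by auto
        then have "\<not> c < d" using g(2) True cd unfolding no_low_ascent_def by blast
        moreover have "c \<noteq> d" using subseq2_distinct[OF _ cd] d(1) by simp
        ultimately show "c > d" by simp
      qed
      then have "p \<in> top_pairs m"
        using True xy u d g ac by (auto simp: top_pairs_def dec_pairs_def)
      then show ?thesis by blast
    next
      case False
      \<comment> \<open>The letter \<open>a\<close> witnesses \<open>m > 0\<close>, so that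
        \<open>m\<close> itself is a letter.\<close>
      have "a \<in> {0<..m}" using u ac(1) by blast
      then have "m \<in> {0<..m}" by simp
      then have "m \<in> set ys" using False u by blast
      then obtain us vs where ys: "ys = us @ m # vs" by (meson split_list)
      have am: "a < m" using ltm[of a] ac(1) False by auto
      \<comment> \<open>A letter \<open>b\<close> before \<open>m\<close> forms an ascent with it,
        hence lies above \<open>a\<close>. Then \<open>c\<close>, being below \<open>a\<close>,
        comes after \<open>m\<close>, and \<open>a b m c\<close> is an occurrence of 2341.\<close>
      have "us = []"
      proof (rule ccontr)
        assume "us \<noteq> []"
        then obtain b where b: "b \<in> set us" by (cases us) auto
        have sb: "subseq [b, m] ys" if "b \<in> set us" for b using that ys by (simp add: subseq_splits)
        have bm: "b < m" if "b \<in> set us" for b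
          using ltm[of b] d(1) that ys by auto
        have ab: "a < b" if "b \<in> set us" for b
        proof -
          have "\<not> b < a" using g(2) sb[OF that] ac bm[OF that] unfolding no_low_ascent_def by blast
          moreover have "a \<noteq> b" using d ac that ys by auto
          ultimately show ?thesis by simp
        qed
        have "c \<noteq> m" "c \<notin> set us" using ab[of c] am ac(3) by auto
        then have "c \<in> set vs" using ac ys by auto
        then have "subseq [a, b, m, c] (xs @ ys)" using b ac(1) unfolding ys
          by (simp add: subseq_splits subseq_singleton_left)
        then show False using g(1) ab[OF b] bm[OF b] ac(3) unfolding good_def by blast
      qed
      then have ys: "ys = m # vs" using ys by simp
      have "set (xs @ m # vs) = {0<..m}" using u ys by simp
      moreover have "\<exists>a\<in>set xs. \<exists>c\<in>set vs. c < a" using ac ys am by auto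
      ultimately have "(xs, vs) \<in> inv_pairs m" using ys g(1) d
        by (auto simp: inv_pairs_def good_words_def)
      then show ?thesis using xy ys by (intro UnI2 image_eqI[of _ _ "(xs, vs)"]) auto
    qed
  next
    fix p assume "p \<in> top_pairs m \<union> ?f ` inv_pairs m"
    then show "p \<in> inv_pairs ?n"
    proof
      assume p: "p \<in> top_pairs m"
      obtain xs ys where xy: "p = (xs, ys)" by fastforce
      have h: "set xs \<union> set ys = {0<..m}" "distinct (xs @ ys)" "ys \<noteq> []" "sorted_wrt (>) ys"
        "good (xs @ ys)" "no_high_ascent xs ys" "m \<in> set xs"
        using p xy by (auto simp: top_pairs_def dec_pairs_def)
      then have "good (xs @ ?n # ys)"
        by (subst good_insert_max) (auto simp: no_low_ascent_sorted)
      moreover have "set (xs @ ?n # ys) = {0<..?n}" using h(1) insert_interval_max by simp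
      moreover have "?n \<notin> set xs \<union> set ys" unfolding h(1) by simp
      \<comment> \<open>The inversion demanded by \<open>inv_pairs\<close> is formed by
        \<open>m\<close> and the first letter of the nonempty word \<open>ys\<close>.\<close>
      moreover have "hd ys \<in> set ys" "hd ys < m"
      proof -
        show "hd ys \<in> set ys" using h by simp
        then have "hd ys \<in> {0<..m}" using h(1) by blast
        then have "hd ys \<le> m" by simp
        moreover have "hd ys \<noteq> m" using \<open>hd ys \<in> set ys\<close> h(2,7) by auto
        ultimately show "hd ys < m" by simp
      qed
      ultimately show ?thesis using h(2,7) xy by (auto simp: inv_pairs_def good_words_def)
    next
      assume "p \<in> ?f ` inv_pairs m"
      then obtain xs vs where xy: "p = (xs, m # vs)" and q: "(xs, vs) \<in> inv_pairs m" by auto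
      have w: "insert m (set xs \<union> set vs) = {0<..m}" "distinct (xs @ m # vs)" "good (xs @ m # vs)"
        using q by (auto simp: inv_pairs_def good_words_def)
      have ex: "\<exists>a\<in>set xs. \<exists>c\<in>set vs. c < a" using q by (auto simp: inv_pairs_def)
      have lt: "\<forall>x\<in>set xs \<union> set vs. x < m"
      proof
        fix x assume x: "x \<in> set xs \<union> set vs"
        then have "x \<in> {0<..m}" using w(1) by blast
        moreover have "x \<noteq> m" using x w(2) by auto
        ultimately show "x < m" by simp
      qed
      have g: "good (xs @ vs)" "no_low_ascent xs vs" "no_high_ascent xs vs"
        using good_insert_max[OF lt] w by auto
      \<comment> \<open>No ascent starts at \<open>m\<close>, which exceeds all of
        \<open>vs\<close>; likewise \<open>m\<close> is not below any letter of
        \<open>xs\<close>.\<close>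
      have "no_low_ascent xs (m # vs)"
        using g(2) lt unfolding no_low_ascent_def subseq2_Cons by (metis UnCI less_asym)
      moreover have "no_high_ascent xs (m # vs)"
        using g(3) lt subseq2_D unfolding no_high_ascent_def by (metis UnCI less_asym set_ConsD)
      ultimately have "good (xs @ ?n # m # vs)"
        using w lt by (subst good_insert_max) auto
      moreover have "set (xs @ ?n # m # vs) = {0<..?n}"
        using w(1) by (simp flip: insert_interval_max)
      moreover have "distinct (xs @ ?n # m # vs)" using w(2) lt[THEN bspec, of ?n] by auto
      ultimately show ?thesis using xy ex by (auto simp: inv_pairs_def good_words_def)
    qed
  qed
  moreover have "top_pairs m \<inter> ?f ` inv_pairs m = {}"
    by (auto simp: top_pairs_def dec_pairs_def)
  moreover have "inj_on ?f (inv_pairs m)" by (auto intro: inj_onI)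
  ultimately show ?thesis by (simp add: card_Un_disjoint card_image)
qed

lemma no_high_ascent_Cons_max:
  assumes "\<forall>x\<in>set xs. x < n"
  shows "no_high_ascent xs (n # ys) \<longleftrightarrow> no_high_ascent xs ys"
proof -
  have "\<not> n < a" if "subseq [a, b] xs" for a b
    using subseq2_D[OF that] assms by (meson less_asym)
  then show ?thesis unfolding no_high_ascent_def by auto
qed

lemma no_high_ascent_Nil: "no_high_ascent xs []"
  by (simp add: no_high_ascent_def)

text \<open>Coefficient form of \<open>U = V + x*F + x*U\<close>. If the maximum is on the right, it
  heads the decreasing word; the middle summand counts the case where it is the whole right
  word.\<close>

lemma card_dec_pairs_Suc:
  "card (dec_pairs 0 (Suc m)) =
     card (top_pairs (Suc m)) + card (good_words 0 m) + card (dec_pairs 0 m)"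
proof -
  let ?n = "Suc m"
  let ?f = "\<lambda>xs. (xs, [?n])"
  let ?g = "\<lambda>(xs, ys). (xs, ?n # ys)"
  have mem: "(xs, ?n # ys) \<in> dec_pairs 0 ?n \<longleftrightarrow>
      (xs, ys) \<in> dec_pairs 0 m \<or> (xs \<in> good_words 0 m \<and> ys = [])" for xs ys
  proof
    assume h: "(xs, ?n # ys) \<in> dec_pairs 0 ?n"
    have d: "distinct (xs @ ys)" "?n \<notin> set xs \<union> set ys" using h by (auto simp: dec_pairs_def)
    have "insert ?n (set xs \<union> set ys) = {0<..?n}" using h by (simp add: dec_pairs_def)
    then have u: "set xs \<union> set ys = {0<..m}" using interval_delete_max d(2) by blast
    have lt: "\<forall>x\<in>set xs \<union> set ys. x < ?n" unfolding u by simp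
    have "good (xs @ ?n # ys)" "sorted_wrt (>) ys" "no_high_ascent xs ys"
      using h lt by (simp_all add: dec_pairs_def no_high_ascent_Cons_max)
    then show "(xs, ys) \<in> dec_pairs 0 m \<or> (xs \<in> good_words 0 m \<and> ys = [])"
      using good_insert_max[OF lt d(1)] d(1) u by (auto simp: dec_pairs_def good_words_def)
  next
    assume h: "(xs, ys) \<in> dec_pairs 0 m \<or> (xs \<in> good_words 0 m \<and> ys = [])"
    then have *: "set xs \<union> set ys = {0<..m} \<and> distinct (xs @ ys) \<and> sorted_wrt (>) ys \<and>
        good (xs @ ys) \<and> no_high_ascent xs ys"
      by (elim disjE conjE) (simp_all add: dec_pairs_def good_words_def no_high_ascent_Nil)
    have u: "set xs \<union> set ys = {0<..m}" and d: "distinct (xs @ ys)" and s: "sorted_wrt (>) ys"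
      and g: "good (xs @ ys)" "no_high_ascent xs ys" by (simp_all only: *)
    have lt: "\<forall>x\<in>set xs \<union> set ys. x < ?n" unfolding u by simp
    have "good (xs @ ?n # ys)"
      using good_insert_max[OF lt d] g no_low_ascent_sorted[OF s] by blast
    moreover have "set (xs @ ?n # ys) = {0<..?n}" using u by (simp flip: insert_interval_max)
    moreover have "distinct (xs @ ?n # ys)" using d lt[THEN bspec, of ?n] by auto
    ultimately show "(xs, ?n # ys) \<in> dec_pairs 0 ?n"
      using s g lt by (simp add: dec_pairs_def no_high_ascent_Cons_max)
  qed
  have "dec_pairs 0 ?n = (top_pairs ?n \<union> ?f ` good_words 0 m) \<union> ?g ` dec_pairs 0 m"
  proof (intro equalityI subsetI)
    fix p assume p: "p \<in> dec_pairs 0 ?n"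
    obtain xs ys where xy: "p = (xs, ys)" by fastforce
    show "p \<in> (top_pairs ?n \<union> ?f ` good_words 0 m) \<union> ?g ` dec_pairs 0 m"
    proof (cases "?n \<in> set xs")
      case True
      then show ?thesis using p xy by (simp add: top_pairs_def)
    next
      case False
      obtain y zs where ys: "ys = y # zs" using p xy by (cases ys) (auto simp: dec_pairs_def)
      have un: "set xs \<union> set ys = {0<..?n}" using p xy by (simp add: dec_pairs_def)
      have "?n \<in> set xs \<union> set ys" unfolding un by simp
      then have n: "?n \<in> insert y (set zs)" using False ys by simp
      have "y \<in> set xs \<union> set ys" using ys by simp
      then have y: "y \<le> ?n" unfolding un by simp
      have "\<forall>z\<in>set zs. z < y" using p xy ys by (simp add: dec_pairs_def)
      then have "y = ?n" using n y by auto
      then have p': "p = (xs, ?n # zs)" using xy ys by simp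
      then have "(xs, zs) \<in> dec_pairs 0 m \<or> (xs \<in> good_words 0 m \<and> zs = [])" using p mem by blast
      then show ?thesis
      proof
        assume "(xs, zs) \<in> dec_pairs 0 m"
        then show ?thesis using p' by (intro UnI2 image_eqI[of _ _ "(xs, zs)"]) simp_all
      qed (use p' in simp)
    qed
  next
    fix p assume "p \<in> (top_pairs ?n \<union> ?f ` good_words 0 m) \<union> ?g ` dec_pairs 0 m"
    then consider "p \<in> top_pairs ?n" | xs where "p = (xs, [?n])" "xs \<in> good_words 0 m"
      | xs ys where "p = (xs, ?n # ys)" "(xs, ys) \<in> dec_pairs 0 m" by auto
    then show "p \<in> dec_pairs 0 ?n"
    proof cases
      case 1
      then show ?thesis by (auto simp: top_pairs_def)
    qed (use mem in blast)+
  qed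
  moreover have "top_pairs ?n \<inter> ?f ` good_words 0 m = {}"
    "(top_pairs ?n \<union> ?f ` good_words 0 m) \<inter> ?g ` dec_pairs 0 m = {}"
    by (auto simp: top_pairs_def dec_pairs_def)
  moreover have "inj_on ?f (good_words 0 m)" "inj_on ?g (dec_pairs 0 m)" by (auto intro: inj_onI)
  ultimately show ?thesis
    by (simp only: card_Un_disjoint card_image finite_UnI finite_imageI finite_top_pairs
        finite_good_words finite_dec_pairs)
qed

text \<open>Coefficient form of \<open>V = x*F*U\<close>: the letters before the maximum lie below
  all other letters, and what follows it is again a pair of the kind counted by
  \<open>U\<close>.\<close>

lemma card_top_pairs_Suc:
  "card (top_pairs (Suc m)) = (\<Sum>j\<le>m. card (good_words 0 j) * card (dec_pairs 0 (m - j)))"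
proof -
  let ?n = "Suc m"
  let ?D = "SIGMA j:{..m}. good_words 0 j \<times> dec_pairs j m"
  let ?f = "\<lambda>(j::nat, us, vs, ys). (us @ ?n # vs, ys)"
  have "top_pairs ?n = ?f ` ?D"
  proof (intro equalityI subsetI)
    fix p assume p: "p \<in> top_pairs ?n"
    obtain xs ys where xy: "p = (xs, ys)" by fastforce
    have "?n \<in> set xs" using p xy by (simp add: top_pairs_def)
    then obtain us vs where xs: "xs = us @ ?n # vs" by (meson split_list)
    have q: "(us @ ?n # vs, ys) \<in> dec_pairs 0 ?n" using p xy xs by (simp add: top_pairs_def)
    have d: "distinct (us @ (vs @ ys))" "?n \<notin> set us \<union> set (vs @ ys)"
      and ne: "ys \<noteq> []" and so: "sorted_wrt (>) ys"
      and g: "good (us @ ?n # (vs @ ys))" and na: "no_high_ascent (us @ ?n # vs) ys"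
      using q by (auto simp: dec_pairs_def)
    have "insert ?n (set us \<union> set (vs @ ys)) = {0<..?n}" using q by (auto simp: dec_pairs_def)
    then have u: "set us \<union> set (vs @ ys) = {0<..m}" using interval_delete_max d(2) by blast
    have lt: "\<forall>x\<in>set us \<union> set (vs @ ys). x < ?n" unfolding u by simp
    \<comment> \<open>Each letter of \<open>us\<close> forms an ascent with the maximum, to which
      \<open>no_high_ascent\<close> applies.\<close>
    have lo: "a < c" if "a \<in> set us" "c \<in> set ys" for a c
    proof -
      have "subseq [a, ?n] (us @ ?n # vs)" using that by (simp add: subseq_splits)
      moreover have "a < ?n" using lt that by blast
      ultimately have "\<not> c < a" using na that(2) unfolding no_high_ascent_def by blast
      moreover have "a \<noteq> c" using d(1) that by auto
      ultimately show ?thesis by simp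
    qed
    \<comment> \<open>Otherwise \<open>a\<close>, the maximum, \<open>b\<close> and
      \<open>hd ys\<close> would form 2413, since \<open>a < hd ys\<close>.\<close>
    have lo': "a < b" if "a \<in> set us" "b \<in> set vs" for a b
    proof (rule ccontr)
      assume "\<not> a < b"
      moreover have "a \<noteq> b" using d(1) that by auto
      ultimately have "b < a" by simp
      have c: "hd ys \<in> set ys" using ne by simp
      then have "subseq [b, hd ys] (vs @ ys)" using that by (simp add: subseq_splits)
      moreover have "a < hd ys" using lo that(1) c by blast
      ultimately have "\<not> no_low_ascent us (vs @ ys)"
        using that(1) \<open>b < a\<close> unfolding no_low_ascent_def by (meson less_trans)
      then show False using good_insert_max[OF lt d(1)] g by blast
    qed
    have sep: "\<forall>x\<in>set us. \<forall>y\<in>set (vs @ ys). x < y" using lo lo' by auto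
    obtain j where j: "j \<le> m" "set us = {0<..j}" "set (vs @ ys) = {j<..m}"
      using interval_split[OF u sep] by auto
    have g': "good us" "good (vs @ ys)" using good_split_max[OF sep lt d(1)] g by simp_all
    have "no_high_ascent vs ys"
      unfolding no_high_ascent_def
    proof (intro allI impI ballI)
      fix a b c assume "subseq [a, b] vs" "a < b" "c \<in> set ys"
      have "subseq [a, b] (us @ ?n # vs)"
        using subseq_drop_many[OF \<open>subseq [a, b] vs\<close>, of "us @ [?n]"] by simp
      then show "\<not> c < a"
        using na \<open>a < b\<close> \<open>c \<in> set ys\<close> unfolding no_high_ascent_def by blast
    qed
    then have "(vs, ys) \<in> dec_pairs j m" using j(3) d(1) ne so g'(2) by (simp add: dec_pairs_def)
    moreover have "us \<in> good_words 0 j" using j(2) d(1) g'(1) by (simp add: good_words_def)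
    ultimately have "(j, us, vs, ys) \<in> ?D" using j(1) by simp
    then show "p \<in> ?f ` ?D" using xy xs by (intro image_eqI[of _ _ "(j, us, vs, ys)"]) simp_all
  next
    fix p assume "p \<in> ?f ` ?D"
    then obtain j us vs ys where p: "p = (us @ ?n # vs, ys)" and j: "j \<le> m"
      and us: "us \<in> good_words 0 j" and q: "(vs, ys) \<in> dec_pairs j m" by auto
    have s: "set us = {0<..j}" "set (vs @ ys) = {j<..m}" and d: "distinct us" "distinct (vs @ ys)"
      and g: "good us" "good (vs @ ys)"
      and r: "ys \<noteq> []" "sorted_wrt (>) ys" "no_high_ascent vs ys"
      using us q by (simp_all add: good_words_def dec_pairs_def)
    have sep: "\<forall>x\<in>set us. \<forall>y\<in>set (vs @ ys). x < y" unfolding s by auto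
    have u: "set us \<union> set (vs @ ys) = {0<..m}" unfolding s using j by auto
    have lt: "\<forall>x\<in>set us \<union> set (vs @ ys). x < ?n" unfolding u by simp
    have dd: "distinct (us @ (vs @ ys))" using d sep by fastforce
    have "good (us @ ?n # (vs @ ys))" using good_split_max[OF sep lt dd] g by simp
    moreover have "no_high_ascent (us @ ?n # vs) ys"
      unfolding no_high_ascent_def
    proof (intro allI impI ballI)
      fix a b c assume ab: "subseq [a, b] (us @ ?n # vs)" "a < b" and c: "c \<in> set ys"
      have nb: "\<not> b < a" using ab(2) by simp
      \<comment> \<open>An ascent starting in \<open>us\<close> starts below all of
        \<open>ys\<close>, none starts at the maximum, and those inside \<open>vs\<close> are
        covered by the hypothesis on \<open>(vs, ys)\<close>.\<close>
      have "a \<in> set us \<or> (a = ?n \<and> b \<in> set vs) \<or> subseq [a, b] vs"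
        using ab(1) subseq2_D[of a b us] unfolding subseq2_append subseq2_Cons by blast
      then show "\<not> c < a"
      proof (elim disjE)
        assume "a \<in> set us"
        then have "a < c" using sep c by simp
        then show ?thesis by simp
      next
        assume "a = ?n \<and> b \<in> set vs"
        moreover from this have "b < ?n" using lt by simp
        ultimately show ?thesis using nb by simp
      next
        assume "subseq [a, b] vs"
        then show ?thesis using r(3) ab(2) c unfolding no_high_ascent_def by blast
      qed
    qed
    moreover have "set ((us @ ?n # vs) @ ys) = {0<..?n}"
      using u by (simp flip: insert_interval_max)
    moreover have "distinct ((us @ ?n # vs) @ ys)" using dd lt[THEN bspec, of ?n] by auto
    ultimately show "p \<in> top_pairs ?n" using p r
      by (simp add: top_pairs_def dec_pairs_def Un_assoc Int_Un_distrib Int_Un_distrib2)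
  qed
  moreover have "inj_on ?f ?D"
  proof (rule inj_onI)
    fix p q assume pq: "p \<in> ?D" "q \<in> ?D" "?f p = ?f q"
    obtain j us vs ys where p: "p = (j, us, vs, ys)" by (metis prod_cases4)
    obtain j' us' vs' ys' where q: "q = (j', us', vs', ys')" by (metis prod_cases4)
    have h: "j \<le> m" "us \<in> good_words 0 j" "(vs, ys) \<in> dec_pairs j m" "us' \<in> good_words 0 j'"
      using pq(1,2) p q by auto
    have s: "set us = {0<..j}" "set us' = {0<..j'}" "set vs \<union> set ys = {j<..m}"
      "distinct us" "distinct vs"
      using h by (simp_all add: good_words_def dec_pairs_def)
    have "set vs \<subseteq> {j<..m}" using s(3) by blast
    then have d: "distinct (us @ ?n # vs)" using s(1,4,5) h(1) by auto
    have e: "us @ ?n # vs = us' @ ?n # vs'" and "ys = ys'" using pq(3) p q by simp_all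
    then have eq: "us = us'" "vs = vs'" "ys = ys'" using split_unique[OF e d] by simp_all
    have "card {0<..j} = card {0<..j'}" using s(1,2) eq by simp
    then show "p = q" using eq p q by simp
  qed
  ultimately have "card (top_pairs ?n) = card ?D" by (simp only: card_image)
  also have "\<dots> = (\<Sum>j\<le>m. card (good_words 0 j) * card (dec_pairs j m))"
    by (rule card_Sigma_Times) auto
  also have "\<dots> = (\<Sum>j\<le>m. card (good_words 0 j) * card (dec_pairs 0 (m - j)))"
    by (intro sum.cong) (auto simp: card_dec_pairs[of _ m])
  finally show ?thesis .
qed

text \<open>The constant terms of \<open>U\<close>, \<open>V\<close> and \<open>W\<close> vanish;
  for \<open>U\<close> this comes from the nonempty right word.\<close>

lemma dec_pairs_0 [simp]: "dec_pairs 0 0 = {}"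
  by (auto simp: dec_pairs_def)

lemma top_pairs_0 [simp]: "top_pairs 0 = {}"
  by (simp add: top_pairs_def)

lemma inv_pairs_0 [simp]: "inv_pairs 0 = {}"
  by (auto simp: inv_pairs_def good_words_def)

subsection \<open>The generating function\<close>

text \<open>Bounded index quantifiers over explicit lists let \<open>All_less_Suc\<close> reduce
  each concrete pattern to a chain of inequalities.\<close>

lemma order_isomorphic_4:
  "order_isomorphic xs [p, q, r, s] \<longleftrightarrow> (\<exists>a b c d. xs = [a, b, c, d] \<and>
     (\<forall>i<4. \<forall>j<4. [a, b, c, d] ! i < [a, b, c, d] ! j \<longleftrightarrow> [p, q, r, s] ! i < [p, q, r, s] ! j))"
  by (auto simp: order_isomorphic_def length_Suc_conv numeral_eq_Suc)

lemma order_isomorphic_2341: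
  "order_isomorphic xs [2, 3, 4, 1] \<longleftrightarrow> (\<exists>a b c d. xs = [a, b, c, d] \<and> d < a \<and> a < b \<and> b < c)"
  unfolding order_isomorphic_4
  by (intro ex_cong1 conj_cong refl) (auto simp: numeral_eq_Suc All_less_Suc)

lemma order_isomorphic_2413:
  "order_isomorphic xs [2, 4, 1, 3] \<longleftrightarrow> (\<exists>a b c d. xs = [a, b, c, d] \<and> c < a \<and> a < d \<and> d < b)"
  unfolding order_isomorphic_4
  by (intro ex_cong1 conj_cong refl) (auto simp: numeral_eq_Suc All_less_Suc)

lemma order_isomorphic_3412:
  "order_isomorphic xs [3, 4, 1, 2] \<longleftrightarrow> (\<exists>a b c d. xs = [a, b, c, d] \<and> c < d \<and> d < a \<and> a < b)"
  unfolding order_isomorphic_4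
  by (intro ex_cong1 conj_cong refl) (auto simp: numeral_eq_Suc All_less_Suc)

lemma good_iff_avoids: "good xs \<longleftrightarrow> (\<forall>\<tau>\<in>{[2,3,4,1], [2,4,1,3], [3,4,1,2]}. avoids xs \<tau>)"
  unfolding good_def avoids_def ball_simps order_isomorphic_2341 order_isomorphic_2413
    order_isomorphic_3412 by blast

lemma avoiders_eq_good_words: "avoiders n {[2,3,4,1], [2,4,1,3], [3,4,1,2]} = good_words 0 n"
  unfolding avoiders_def good_words_def permutations_of_set_def good_iff_avoids[symmetric]
    atLeastSucAtMost_greaterThanAtMost[symmetric] by auto

theorem theorem3p35:
  fixes T :: "nat list set" and F :: "int fps"
  defines "T \<equiv> {[2,3,4,1], [2,4,1,3], [3,4,1,2]}"
  defines "F \<equiv> avoiders_gf T"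
  shows "F = (1 - fps_X)^2 + fps_X * F + fps_X * (2 - 3 * fps_X + 2 * fps_X^2) * F^2
             - fps_X^2 * (1 - fps_X) * F^3"
proof -
  define U where "U = Abs_fps (\<lambda>n. int (card (dec_pairs 0 n)))"
  define V where "V = Abs_fps (\<lambda>n. int (card (top_pairs n)))"
  define W where "W = Abs_fps (\<lambda>n. int (card (inv_pairs n)))"
  have F: "F = Abs_fps (\<lambda>n. int (card (good_words 0 n)))"
    unfolding F_def T_def avoiders_gf_def avoiders_eq_good_words ..
  have nth_F: "fps_nth F n = int (card (good_words 0 n))" for n
    by (simp add: F)
  have nth_FF: "fps_nth (F * F) n = (\<Sum>j\<le>n. int (card (good_words 0 j) * card (good_words 0 (n - j))))"
    for n
    by (simp add: fps_mult_nth nth_F atLeast0AtMost)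
  have nth_FU: "fps_nth (F * U) n = (\<Sum>j\<le>n. int (card (good_words 0 j) * card (dec_pairs 0 (n - j))))"
    for n
    by (simp add: fps_mult_nth nth_F U_def atLeast0AtMost)
  have "F = 1 + fps_X * (F * F) + W"
  proof (rule fps_ext)
    fix n show "fps_nth F n = fps_nth (1 + fps_X * (F * F) + W) n"
      unfolding fps_add_nth fps_X_mult_nth nth_FF nth_F
      by (cases n) (simp_all add: W_def card_good_words_Suc)
  qed
  then have eqF: "W = F - 1 - fps_X * F^2" by (simp add: algebra_simps power2_eq_square)
  have "W = fps_X * V + fps_X * W"
  proof (rule fps_ext)
    fix n show "fps_nth W n = fps_nth (fps_X * V + fps_X * W) n"
      by (cases n) (simp_all add: V_def W_def card_inv_pairs_Suc)
  qed
  then have eqW: "(1 - fps_X) * W = fps_X * V" by (simp add: algebra_simps)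
  have eqU: "U = V + fps_X * F + fps_X * U"
  proof (rule fps_ext)
    fix n show "fps_nth U n = fps_nth (V + fps_X * F + fps_X * U) n"
      by (cases n) (simp_all add: nth_F U_def V_def card_dec_pairs_Suc)
  qed
  have eqV: "V = fps_X * (F * U)"
  proof (rule fps_ext)
    fix n show "fps_nth V n = fps_nth (fps_X * (F * U)) n"
      unfolding fps_X_mult_nth nth_FU by (cases n) (simp_all add: V_def card_top_pairs_Suc)
  qed
  \<comment> \<open>Elimination: \<open>V\<close> is substituted first, then this equation removes
    \<open>U\<close> from \<open>(1 - x)*W = x^2*F*U\<close> after multiplication by
    \<open>1 - x - x*F\<close>.\<close>
  have "(1 - fps_X - fps_X * F) * U = fps_X * F"
    using eqU unfolding eqV by (simp add: algebra_simps)
  then have "(1 - fps_X) * (1 - fps_X - fps_X * F) * W = fps_X^3 * F^2"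
    using eqW unfolding eqV by algebra
  then have "(1 - fps_X) * (1 - fps_X - fps_X * F) * (F - 1 - fps_X * F^2) = fps_X^3 * F^2"
    unfolding eqF .
  \<comment> \<open>Pure expansion without division: \<open>x*(1 - x)*(2 - x) + x^3\<close> is the
    coefficient \<open>x*(2 - 3*x + 2*x^2)\<close> of \<open>F^2\<close>.\<close>
  then show ?thesis by algebra
qed

end
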